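(* Let $\mathbb{P}$ be a poset with least element $0$, and let $I,Z\subseteq\mathbb{P}$. Suppose that $I$ and $Z$ are both $Z$-complete and that $Z$ is $Z$-central. Then $I\cap Z$ is a complete ideal of $Z$ (regarded as a poset in the induced order) and an upper complete sublattice of $\mathbb{P}$. Moreover, $z=\bigvee (I\cap Z)$ is the unique $z\in Z$ such that, for all $y\in Z$, $$y\wedge z=0\quad\Leftrightarrow\quad[0,y]\cap I\cap Z=\{0\}.$$
   Context: Suprema $\bigvee,\vee$ and infima $\bigwedge,\wedge$ are taken in $\mathbb{P}$ and need not exist in general; any assertion such as $\bigvee S\in I$, $p\vee q\in I$, $p=q\vee r$ or $y\wedge z=0$ includes the assertion that the supremum/infimum exists. $[0,y]=\{p\in\mathbb{P}:p\leq y\}$. A set $S\subseteq\mathbb{P}$ is $Z$-disjoint if there is $f:S\to Z$ with $p\leq f(p)$ for all $p\in S$ and $f(p)\wedge f(q)=0$ for all distinct $p,q\in S$. A set $J\subseteq\mathbb{P}$ is $Z$-complete if (1) $\bigvee S\in J$ whenever $S\subseteq J$ is $Z$-disjoint, and (2) $p,q\in J$ whenever $p,q\in\mathbb{P}$, $p\vee q\in J$ and $\{p,q\}$ is $Z$-disjoint. For $S\subseteq\mathbb{P}$, $Z$ is $S$-central if for all $p\in S$ and $y\in Z$ there is $z\in Z$ with $y\wedge z=0$ and $p=q\vee r$ for some $q,r\in\mathbb{P}$ with $q\leq y$ and $r\leq z$. ($Z$-central is the case $S=Z$.) A subset $J$ of a poset $Q$ is a complete ideal of $Q$ if it is a lower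 set in $Q$ ($p\in Q$, $p\leq q\in J$ implies $p\in J$) and is completely upwards directed (for every $S\subseteq J$ there is $q\in J$ with $p\leq q$ for all $p\in S$). $J$ is an upper complete sublattice of $Q$ if every $S\subseteq J$ has a supremum in $Q$ and this supremum belongs to $J$. *)

theory Defs
  imports "HOL-Library.Lub_Glb"
begin

text \<open>
  The poset with least element is the universe of a type of class \<^class>\<open>order_bot\<close>.
  Suprema and infima need not exist, so they are expressed by the relations
  \<^const>\<open>isLub\<close> and \<^const>\<open>isGlb\<close>; a set of discourse \<^term>\<open>UNIV\<close> means that they
  are taken in the whole poset, and every use includes existence.
\<close>

definition Z_disjoint :: "'a::order_bot set \<Rightarrow> 'a set \<Rightarrow> bool" where
  "Z_disjoint Z S \<longleftrightarrow>
     (\<exists>f. (\<forall>p\<in>S. f p \<in> Z \<and> p \<le> f p) \<and>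
          (\<forall>p\<in>S. \<forall>q\<in>S. p \<noteq> q \<longrightarrow> isGlb UNIV {f p, f q} bot))"

definition Z_complete :: "'a::order_bot set \<Rightarrow> 'a set \<Rightarrow> bool" where
  "Z_complete Z J \<longleftrightarrow>
     (\<forall>S. S \<subseteq> J \<and> Z_disjoint Z S \<longrightarrow> (\<exists>s. isLub UNIV S s \<and> s \<in> J)) \<and>
     (\<forall>p q. (\<exists>s. isLub UNIV {p, q} s \<and> s \<in> J) \<and> Z_disjoint Z {p, q} \<longrightarrow> p \<in> J \<and> q \<in> J)"

text \<open>\<^term>\<open>central_for S Z\<close>: the set \<^term>\<open>Z\<close> is \<^term>\<open>S\<close>-central.\<close>

definition central_for :: "'a::order_bot set \<Rightarrow> 'a set \<Rightarrow> bool" where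
  "central_for S Z \<longleftrightarrow>
     (\<forall>p\<in>S. \<forall>y\<in>Z. \<exists>z\<in>Z. isGlb UNIV {y, z} bot \<and>
        (\<exists>q r. isLub UNIV {q, r} p \<and> q \<le> y \<and> r \<le> z))"

text \<open>Subsets \<^term>\<open>Q\<close> of a type are regarded as posets in the induced order.\<close>

definition complete_ideal :: "'a::order set \<Rightarrow> 'a set \<Rightarrow> bool" where
  "complete_ideal Q J \<longleftrightarrow> J \<subseteq> Q \<and>
     (\<forall>p\<in>Q. \<forall>q\<in>J. p \<le> q \<longrightarrow> p \<in> J) \<and>
     (\<forall>S. S \<subseteq> J \<longrightarrow> (\<exists>q\<in>J. \<forall>p\<in>S. p \<le> q))"

definition upper_complete_sublattice :: "'a::order set \<Rightarrow> 'a set \<Rightarrow> bool" where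
  "upper_complete_sublattice Q J \<longleftrightarrow> J \<subseteq> Q \<and>
     (\<forall>S. S \<subseteq> J \<longrightarrow> (\<exists>s. isLub Q S s \<and> s \<in> J))"

end

theory Submission
  imports Defs
begin

text \<open>
  Call \<open>x\<close> and \<open>y\<close> orthogonal if \<open>x \<sqinter> y = 0\<close>. Centrality and completeness split every \<open>p \<in> Z\<close>
  along any \<open>y \<in> Z\<close> as \<open>p = q \<squnion> r\<close> with \<open>q, r \<in> Z\<close>, \<open>q \<le> y\<close> and \<open>r\<close> orthogonal to \<open>y\<close>. No
  distributivity is available, so \<open>q\<close> need not be \<open>p \<sqinter> y\<close>; but if \<open>y \<le> p\<close> then also \<open>p = y \<squnion> r\<close>,
  which makes \<open>I \<inter> Z\<close> a lower set in \<open>Z\<close>. For \<open>S \<subseteq> I \<inter> Z\<close>, take a maximal pairwise orthogonal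
  family in \<open>I \<inter> Z\<close> of elements below all upper bounds of \<open>S\<close>. Its supremum \<open>u\<close> exists, and
  splitting \<open>s \<in> S\<close> along \<open>u\<close> leaves a part that could be added to the family, hence is \<open>0\<close>;
  so \<open>u = \<Squnion> S\<close>.
\<close>

lemma isLub_UNIV_iff:
  fixes s :: "'a::order"
  shows "isLub UNIV S s \<longleftrightarrow> (\<forall>x\<in>S. x \<le> s) \<and> (\<forall>u. (\<forall>x\<in>S. x \<le> u) \<longrightarrow> s \<le> u)"
  by (auto simp: isLub_def leastP_def isUb_def setle_def setge_def)

lemma isGlb_bot_iff:
  fixes x y :: "'a::order_bot"
  shows "isGlb UNIV {x, y} bot \<longleftrightarrow> (\<forall>c. c \<le> x \<longrightarrow> c \<le> y \<longrightarrow> c = bot)"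
  by (auto simp: isGlb_def greatestP_def isLb_def setle_def setge_def bot_unique)

definition orthogonal :: "'a::order_bot \<Rightarrow> 'a \<Rightarrow> bool" where
  "orthogonal x y \<longleftrightarrow> isGlb UNIV {x, y} bot"

lemma orthogonalD: "orthogonal x y \<Longrightarrow> c \<le> x \<Longrightarrow> c \<le> y \<Longrightarrow> c = bot"
  by (simp add: orthogonal_def isGlb_bot_iff)

lemma orthogonal_sym: "orthogonal x y \<Longrightarrow> orthogonal y x"
  by (simp add: orthogonal_def insert_commute)

lemma orthogonal_mono: "orthogonal x y \<Longrightarrow> a \<le> x \<Longrightarrow> b \<le> y \<Longrightarrow> orthogonal a b"
  unfolding orthogonal_def isGlb_bot_iff by (meson order_trans)

lemma Z_disjoint_pairwise_orthogonal:
  assumes "S \<subseteq> Z" "pairwise orthogonal S"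
  shows "Z_disjoint Z S"
  unfolding Z_disjoint_def
  by (rule exI[of _ id]) (use assms in \<open>auto simp: pairwise_def orthogonal_def\<close>)

lemma Z_disjoint_pair:
  assumes "y \<in> Z" "z \<in> Z" "orthogonal y z" "q \<le> y" "r \<le> z"
  shows "Z_disjoint Z {q, r}"
  unfolding Z_disjoint_def
  \<comment> \<open>If \<open>q = r\<close>, this witness is constantly \<open>y\<close> on a
    singleton, and orthogonality is vacuous.\<close>
  by (rule exI[of _ "\<lambda>x. if x = q then y else z"])
    (use assms orthogonal_sym[OF assms(3)] in \<open>auto simp: orthogonal_def\<close>)

lemma Z_complete_Sup:
  assumes "Z_complete Z J" "S \<subseteq> J" "S \<subseteq> Z" "pairwise orthogonal S"
  obtains s where "isLub UNIV S s" "s \<in> J"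
  using assms Z_disjoint_pairwise_orthogonal[of S Z] unfolding Z_complete_def by blast

lemma Z_complete_parts:
  assumes "Z_complete Z J" "isLub UNIV {p, q} s" "s \<in> J" "Z_disjoint Z {p, q}"
  shows "p \<in> J" "q \<in> J"
  using assms unfolding Z_complete_def by blast+

text \<open>The empty set is \<open>Z\<close>-disjoint, and its supremum is
  \<open>bot\<close>.\<close>

lemma bot_in_Z_complete:
  assumes "Z_complete Z J"
  shows "bot \<in> J"
proof -
  obtain s where s: "isLub UNIV {} s" "s \<in> J"
    using Z_complete_Sup[OF assms, of "{}"] by auto
  then have "s \<le> bot" by (auto simp: isLub_UNIV_iff)
  then show ?thesis using s(2) by (simp add: bot_unique)
qed

lemma isLub_bot_right:
  fixes p q :: "'a::order_bot"
  assumes "isLub UNIV {q, bot} p"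
  shows "p = q"
  using assms by (auto simp: isLub_UNIV_iff intro: order.antisym)

context
  fixes Z :: "'a::order_bot set"
  assumes complete: "Z_complete Z Z" and central: "central_for Z Z"
begin

text \<open>Centrality only yields \<open>q\<close> and \<open>r\<close> in the whole poset. Since
  they lie below orthogonal elements of \<open>Z\<close>, the pair is \<open>Z\<close>-disjoint, and
  the second half of completeness puts both into \<open>Z\<close>.\<close>

lemma central_split:
  assumes "p \<in> Z" "y \<in> Z"
  obtains q r where "q \<in> Z" "r \<in> Z" "isLub UNIV {q, r} p" "q \<le> y" "orthogonal r y"
proof -
  obtain z q r where z: "z \<in> Z" "orthogonal y z" and qr: "isLub UNIV {q, r} p" "q \<le> y" "r \<le> z"
    using central assms unfolding central_for_def orthogonal_def by blast
  have "Z_disjoint Z {q, r}"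
    by (rule Z_disjoint_pair[OF assms(2) z qr(2,3)])
  from Z_complete_parts[OF complete qr(1) assms(1) this] have "q \<in> Z" "r \<in> Z" .
  moreover have "orthogonal r y"
    by (rule orthogonal_sym[OF orthogonal_mono[OF z(2) order_refl qr(3)]])
  ultimately show thesis using that qr by blast
qed

text \<open>Splitting \<open>p\<close> along \<open>y\<close> leaves no part orthogonal to
  \<open>y\<close>, so \<open>p\<close> is its part below \<open>y\<close>. This is the way to prove
  inequalities in \<open>Z\<close> without distributivity.\<close>

lemma le_if_orthogonal_parts_trivial:
  assumes "p \<in> Z" "y \<in> Z"
    and "\<And>r. r \<in> Z \<Longrightarrow> r \<le> p \<Longrightarrow> orthogonal r y \<Longrightarrow> r = bot"
  shows "p \<le> y"
proof -
  obtain q r where qr: "q \<in> Z" "r \<in> Z" "isLub UNIV {q, r} p" "q \<le> y" "orthogonal r y"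
    using central_split[OF assms(1,2)] .
  then have "r = bot" using assms(3) by (simp add: isLub_UNIV_iff)
  then show ?thesis using isLub_bot_right qr by blast
qed

lemma Z_complete_lower:
  assumes "Z_complete Z I" "p \<in> Z" "q \<in> I" "q \<in> Z" "p \<le> q"
  shows "p \<in> I"
proof -
  obtain a b where ab: "a \<in> Z" "b \<in> Z" "isLub UNIV {a, b} q" "a \<le> p" "orthogonal b p"
    using central_split[OF assms(4,2)] .
  \<comment> \<open>As \<open>a \<le> p \<le> q\<close>, enlarging \<open>a\<close> to
    \<open>p\<close> keeps the supremum.\<close>
  have "isLub UNIV {p, b} q"
    using ab(3,4) assms(5) unfolding isLub_UNIV_iff by (auto intro: order_trans)
  moreover have "Z_disjoint Z {p, b}"
    by (rule Z_disjoint_pair[OF assms(2) ab(2) orthogonal_sym[OF ab(5)] order_refl order_refl])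
  ultimately show ?thesis
    using Z_complete_parts assms(1,3) by blast
qed

lemma Z_complete_Sup_arbitrary:
  assumes I: "Z_complete Z I" and S: "S \<subseteq> I \<inter> Z"
  obtains u where "isLub UNIV S u" "u \<in> I" "u \<in> Z"
proof -
  \<comment> \<open>\<open>L\<close> refers to upper bounds of \<open>S\<close> because its supremum
    is not yet known to exist.\<close>
  define L where "L = {t \<in> I \<inter> Z. \<forall>b. (\<forall>s\<in>S. s \<le> b) \<longrightarrow> t \<le> b}"
  define F where "F = {T. T \<subseteq> L \<and> pairwise orthogonal T}"
  have "\<exists>M\<in>F. \<forall>X\<in>F. M \<subseteq> X \<longrightarrow> X = M"
  proof (rule subset_Zorn')
    fix C assume "subset.chain F C"
    then have C: "C \<subseteq> F" "chain\<^sub>\<subseteq> C"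
      by (auto simp: subset_chain_def chain_subset_def)
    then have "pairwise orthogonal (\<Union> C)"
      by (intro pairwise_chain_Union) (auto simp: F_def)
    then show "\<Union> C \<in> F" using C(1) by (auto simp: F_def)
  qed
  then obtain M where "M \<in> F" and "\<forall>X\<in>F. M \<subseteq> X \<longrightarrow> X = M" ..
  then have M: "M \<subseteq> L" "pairwise orthogonal M"
    and max: "\<And>X. X \<subseteq> L \<Longrightarrow> pairwise orthogonal X \<Longrightarrow> M \<subseteq> X \<Longrightarrow> X = M"
    by (simp_all add: F_def)
  have MIZ: "M \<subseteq> I" "M \<subseteq> Z" using M(1) by (auto simp: L_def)
  obtain u where u: "isLub UNIV M u" "u \<in> I"
    using Z_complete_Sup[OF I MIZ M(2)] .
  \<comment> \<open>Completeness of \<open>I\<close> and of \<open>Z\<close> each provide a supremum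
    of \<open>M\<close>; by uniqueness of suprema it lies in both sets.\<close>
  obtain u' where "isLub UNIV M u'" "u' \<in> Z"
    using Z_complete_Sup[OF complete MIZ(2) MIZ(2) M(2)] .
  then have uZ: "u \<in> Z"
    using u(1) by (metis isLub_UNIV_iff order.antisym)
  have "s \<le> u" if s: "s \<in> S" for s
  proof (rule le_if_orthogonal_parts_trivial)
    show "s \<in> Z" "u \<in> Z" using s S uZ by auto
    fix r assume r: "r \<in> Z" "r \<le> s" "orthogonal r u"
    have "r \<in> I" using Z_complete_lower[OF I r(1) _ _ r(2)] s S by blast
    then have "r \<in> L" using r(1,2) s unfolding L_def by (auto intro: order_trans)
    moreover have "orthogonal r m \<and> orthogonal m r" if "m \<in> M" for m
    proof -
      have "m \<le> u" using that u(1) by (simp add: isLub_UNIV_iff)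
      then have "orthogonal r m" by (rule orthogonal_mono[OF r(3) order_refl])
      then show ?thesis using orthogonal_sym by blast
    qed
    \<comment> \<open>Maximality forces \<open>r\<close> into \<open>M\<close>, hence below
      \<open>u\<close>, to which it is orthogonal.\<close>
    ultimately have "insert r M = M"
      using M by (intro max) (auto simp: pairwise_insert)
    then have "r \<le> u" using u(1) by (auto simp: isLub_UNIV_iff)
    then show "r = bot" using orthogonalD[OF r(3)] by simp
  qed
  moreover have "u \<le> b" if "\<forall>s\<in>S. s \<le> b" for b
  proof -
    have "\<forall>m\<in>M. m \<le> b" using that M(1) unfolding L_def by blast
    then show ?thesis using u(1) by (simp add: isLub_UNIV_iff)
  qed
  ultimately have "isLub UNIV S u" by (simp add: isLub_UNIV_iff)
  then show thesis using that u(2) uZ by blast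
qed

text \<open>A part of \<open>w\<close> orthogonal to \<open>z\<close> is orthogonal to
  \<open>w\<close> as well, hence to itself, so it is \<open>bot\<close>. Used in both directions,
  this gives uniqueness in the theorem.\<close>

lemma le_if_orthogonal_imp:
  assumes "w \<in> Z" "z \<in> Z" "\<And>y. y \<in> Z \<Longrightarrow> orthogonal y z \<Longrightarrow> orthogonal y w"
  shows "w \<le> z"
  using assms by (intro le_if_orthogonal_parts_trivial) (auto dest: orthogonalD)

lemma orthogonal_Sup_iff:
  assumes I: "Z_complete Z I" and z: "isLub UNIV (I \<inter> Z) z" "z \<in> I" "z \<in> Z" and y: "y \<in> Z"
  shows "orthogonal y z \<longleftrightarrow> {..y} \<inter> I \<inter> Z = {bot}"
proof
  assume "orthogonal y z"
  moreover have "x \<le> z" if "x \<in> I" "x \<in> Z" for x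
    using z(1) that by (auto simp: isLub_UNIV_iff)
  ultimately show "{..y} \<inter> I \<inter> Z = {bot}"
    using bot_in_Z_complete[OF I] bot_in_Z_complete[OF complete] by (auto dest: orthogonalD)
next
  assume bot: "{..y} \<inter> I \<inter> Z = {bot}"
  \<comment> \<open>The part of \<open>z\<close> below \<open>y\<close> lies in
    \<open>I \<inter> Z\<close> and so vanishes, leaving \<open>z\<close> equal to its part
    orthogonal to \<open>y\<close>.\<close>
  obtain q r where qr: "q \<in> Z" "r \<in> Z" "isLub UNIV {q, r} z" "q \<le> y" "orthogonal r y"
    using central_split[OF z(3) y] .
  have "q \<in> I"
    using Z_complete_lower[OF I qr(1) z(2,3)] qr(3) by (simp add: isLub_UNIV_iff)
  then have "q = bot" using bot qr by blast
  then have "z = r" using qr(3) isLub_bot_right by (metis insert_commute)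
  then show "orthogonal y z" using qr(5) orthogonal_sym by blast
qed

end

theorem theorem2p4:
  fixes I Z :: "'a::order_bot set"
  assumes "Z_complete Z I"
    and "Z_complete Z Z"
    and "central_for Z Z"
  shows "complete_ideal Z (I \<inter> Z) \<and>
         upper_complete_sublattice UNIV (I \<inter> Z) \<and>
         (\<exists>z. isLub UNIV (I \<inter> Z) z \<and>
              z \<in> Z \<and>
              (\<forall>y\<in>Z. isGlb UNIV {y, z} bot \<longleftrightarrow> {..y} \<inter> I \<inter> Z = {bot}) \<and>
              (\<forall>w\<in>Z. (\<forall>y\<in>Z. isGlb UNIV {y, w} bot \<longleftrightarrow> {..y} \<inter> I \<inter> Z = {bot}) \<longrightarrow> w = z))"
proof -
  note cc = assms(2,3)
  obtain z where z: "isLub UNIV (I \<inter> Z) z" "z \<in> I" "z \<in> Z"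
    using Z_complete_Sup_arbitrary[OF cc assms(1) order_refl] .
  \<comment> \<open>As a member of \<open>I \<inter> Z\<close>, \<open>z\<close> is its greatest
    element and bounds all its subsets at once, which gives complete directedness.\<close>
  have "\<forall>p\<in>I \<inter> Z. p \<le> z" using z(1) by (simp add: isLub_UNIV_iff)
  then have ideal: "complete_ideal Z (I \<inter> Z)"
    using Z_complete_lower[OF cc assms(1)] z unfolding complete_ideal_def by blast
  have sublattice: "upper_complete_sublattice UNIV (I \<inter> Z)"
    unfolding upper_complete_sublattice_def
    using Z_complete_Sup_arbitrary[OF cc assms(1)] by (metis IntI subset_UNIV)
  have iff: "\<forall>y\<in>Z. isGlb UNIV {y, z} bot \<longleftrightarrow> {..y} \<inter> I \<inter> Z = {bot}"
    using orthogonal_Sup_iff[OF cc assms(1) z] by (simp add: orthogonal_def)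
  \<comment> \<open>Both \<open>w\<close> and \<open>z\<close> are orthogonal to the same elements
    of \<open>Z\<close>.\<close>
  have "w = z" if "w \<in> Z" "\<forall>y\<in>Z. isGlb UNIV {y, w} bot \<longleftrightarrow> {..y} \<inter> I \<inter> Z = {bot}" for w
    using le_if_orthogonal_imp[OF cc, of w z] le_if_orthogonal_imp[OF cc, of z w] that z(3) iff
    by (simp add: orthogonal_def order.antisym)
  then show ?thesis using ideal sublattice z iff by blast
qed

end
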